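(* Let $(M,g)$ be a Riemannian manifold whose metric $g=g(t)$ evolves under the Yamabe flow $\frac{\partial g}{\partial t}=(S-R)g$, and let $W_{ijkl}$ be its Weyl curvature tensor. Then $$\frac{\partial W_{ijkl}}{\partial t}=(S-R)\,W_{ijkl}.$$
   Context: $M$ is a smooth manifold of dimension $n\ge 3$. $g=g(t)$ is a one-parameter family of Riemannian metrics on $M$. $R=R(t)$ is the scalar curvature of $g(t)$, and $S=S(t)=\frac{1}{\mathrm{Vol}(M,g(t))}\int_M R\,dV_{g(t)}$ is the average scalar curvature of $g(t)$ (a function of $t$ only, assumed to be defined). The Yamabe flow is the evolution equation $\frac{\partial g_{ij}}{\partial t}=(S-R)g_{ij}$. Components are taken with respect to a fixed ($t$-independent) local coordinate frame $(e_i)$. With $R_{ijkl}=g(R(e_i,e_j)e_k,e_l)$ the Riemann curvature tensor, $R_{jk}=g^{il}R_{ijkl}$ the Ricci tensor and $R=g^{jk}R_{jk}$, the Weyl curvature tensor is $$W_{ijkl}=R_{ijkl}-\frac{1}{n-2}\left(g_{jk}R_{il}-g_{ik}R_{jl}+g_{il}R_{jk}-g_{jl}R_{ik}\right)+\frac{R}{(n-1)(n-2)}\left(g_{il}g_{jk}-g_{jl}g_{ik}\right).$$ *)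

theory Defs
  imports "HOL-Analysis.Analysis"
begin

section \<open>Smooth maps\<close>

text \<open>
  Derivatives are taken within the set, so that the definition also makes sense on sets
  like \<open>{0..<a} \<times> V\<close> with \<open>V\<close> open (one-sided derivatives at the boundary). On the sets
  used below derivatives within the set are unique.
\<close>

fun Ck_on :: "nat \<Rightarrow> 'a::euclidean_space set \<Rightarrow> ('a \<Rightarrow> 'b::real_normed_vector) \<Rightarrow> bool" where
  "Ck_on 0 D f \<longleftrightarrow> continuous_on D f"
| "Ck_on (Suc k) D f \<longleftrightarrow>
     (\<exists>f'. (\<forall>x\<in>D. (f has_derivative f' x) (at x within D)) \<and> (\<forall>v. Ck_on k D (\<lambda>x. f' x v)))"

definition smooth_on :: "'a::euclidean_space set \<Rightarrow> ('a \<Rightarrow> 'b::real_normed_vector) \<Rightarrow> bool" where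
  "smooth_on D f \<longleftrightarrow> (\<forall>k. Ck_on k D f)"

section \<open>Smooth manifolds\<close>

text \<open>A chart is its domain together with the coordinate map; values of the map outside
  the domain are irrelevant. The dimension of the manifold is \<open>CARD('n)\<close>.\<close>

type_synonym ('a, 'n) chart = "'a set \<times> ('a \<Rightarrow> real ^ 'n)"

abbreviation dom_chart :: "('a, 'n::finite) chart \<Rightarrow> 'a set" where
  "dom_chart c \<equiv> fst c"

abbreviation coord :: "('a, 'n::finite) chart \<Rightarrow> 'a \<Rightarrow> real ^ 'n" where
  "coord c \<equiv> snd c"

definition is_chart :: "'a topology \<Rightarrow> ('a, 'n::finite) chart \<Rightarrow> bool" where
  "is_chart X c \<longleftrightarrow>
     openin X (dom_chart c) \<and> open (coord c ` dom_chart c) \<and>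
     homeomorphic_map (subtopology X (dom_chart c)) (top_of_set (coord c ` dom_chart c)) (coord c)"

definition transition ::
    "('a, 'n::finite) chart \<Rightarrow> ('a, 'n) chart \<Rightarrow> real ^ 'n \<Rightarrow> real ^ 'n" where
  "transition c d = (\<lambda>x. coord d (inv_into (dom_chart c) (coord c) x))"

text \<open>The atlas is not required to be maximal; a maximal atlas is a special case.\<close>

definition smooth_manifold :: "'a topology \<Rightarrow> ('a, 'n::finite) chart set \<Rightarrow> bool" where
  "smooth_manifold X A \<longleftrightarrow>
     Hausdorff_space X \<and> second_countable X \<and>
     (\<forall>c\<in>A. is_chart X c) \<and> (\<Union>c\<in>A. dom_chart c) = topspace X \<and>
     (\<forall>c\<in>A. \<forall>d\<in>A. smooth_on (coord c ` (dom_chart c \<inter> dom_chart d)) (transition c d))"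

section \<open>Riemannian metrics and their volume measure\<close>

text \<open>
  A metric is given by its component matrices: \<open>g c x $ i $ j\<close> is \<open>g\<^sub>i\<^sub>j\<close> with respect to the
  coordinate frame of the chart \<open>c\<close>, at the point with coordinates \<open>x\<close>. That the families of
  components for the various charts form one (0,2)-tensor field is expressed by the
  transformation law.
\<close>

type_synonym ('a, 'n) metric = "('a, 'n) chart \<Rightarrow> real ^ 'n \<Rightarrow> real ^ 'n ^ 'n"

definition riemannian_metric :: "('a, 'n::finite) chart set \<Rightarrow> ('a, 'n) metric \<Rightarrow> bool" where
  "riemannian_metric A g \<longleftrightarrow>
     (\<forall>c\<in>A. smooth_on (coord c ` dom_chart c) (g c)) \<and>
     (\<forall>c\<in>A. \<forall>x\<in>coord c ` dom_chart c.
        transpose (g c x) = g c x \<and> (\<forall>v. v \<noteq> 0 \<longrightarrow> v \<bullet> (g c x *v v) > 0)) \<and>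
     (\<forall>c\<in>A. \<forall>d\<in>A. \<forall>p\<in>dom_chart c \<inter> dom_chart d.
        let J = matrix (frechet_derivative (transition c d) (at (coord c p)))
        in g c (coord c p) = transpose J ** g d (coord d p) ** J)"

text \<open>\<open>dV\<^sub>g\<close> is the unique Borel measure that has density \<open>sqrt (det g)\<close> with respect to
  Lebesgue measure in each chart.\<close>

definition volume_measure ::
    "'a topology \<Rightarrow> ('a, 'n::finite) chart set \<Rightarrow> ('a, 'n) metric \<Rightarrow> 'a measure" where
  "volume_measure X A g = (THE \<mu>.
     sets \<mu> = sets (sigma (topspace X) {U. openin X U}) \<and>
     (\<forall>c\<in>A. \<forall>B\<in>sets \<mu>. B \<subseteq> dom_chart c \<longrightarrow>
        emeasure \<mu> B = (\<integral>\<^sup>+x\<in>coord c ` B. ennreal (sqrt (det (g c x))) \<partial>lborel)))"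

section \<open>Curvature in coordinates\<close>

text \<open>
  Throughout, \<open>G\<close> is the component matrix of a metric on an open set of coordinate space,
  vector fields are functions \<open>real ^ 'n \<Rightarrow> real ^ 'n\<close>, and \<open>frame i\<close> is the i-th coordinate
  vector field.
\<close>

definition partial :: "'n::finite \<Rightarrow> (real ^ 'n \<Rightarrow> real) \<Rightarrow> real ^ 'n \<Rightarrow> real" where
  "partial i f x = frechet_derivative f (at x) (axis i 1)"

definition frame :: "'n::finite \<Rightarrow> real ^ 'n \<Rightarrow> real ^ 'n" where
  "frame i = (\<lambda>x. axis i 1)"

text \<open>\<open>christoffel G k i j\<close> is the symbol with upper index \<open>k\<close> and lower indices \<open>i\<close>, \<open>j\<close>.\<close>

definition christoffel ::
    "(real ^ 'n \<Rightarrow> real ^ 'n ^ 'n) \<Rightarrow> 'n::finite \<Rightarrow> 'n \<Rightarrow> 'n \<Rightarrow> real ^ 'n \<Rightarrow> real" where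
  "christoffel G k i j x =
     (1/2) * (\<Sum>l\<in>UNIV. matrix_inv (G x) $ k $ l *
        (partial i (\<lambda>y. G y $ j $ l) x + partial j (\<lambda>y. G y $ i $ l) x
         - partial l (\<lambda>y. G y $ i $ j) x))"

text \<open>\<open>nabla G Y Z\<close> is the Levi-Civita covariant derivative of \<open>Z\<close> in the direction of \<open>Y\<close>.\<close>

definition nabla ::
    "(real ^ 'n \<Rightarrow> real ^ 'n ^ 'n) \<Rightarrow> (real ^ 'n \<Rightarrow> real ^ 'n) \<Rightarrow> (real ^ 'n \<Rightarrow> real ^ 'n)
      \<Rightarrow> real ^ 'n \<Rightarrow> real ^ 'n::finite" where
  "nabla G Y Z = (\<lambda>x. \<chi> k.
     (\<Sum>i\<in>UNIV. Y x $ i * partial i (\<lambda>y. Z y $ k) x)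
     + (\<Sum>i\<in>UNIV. \<Sum>j\<in>UNIV. christoffel G k i j x * Y x $ i * Z x $ j))"

definition lie_bracket ::
    "(real ^ 'n \<Rightarrow> real ^ 'n) \<Rightarrow> (real ^ 'n \<Rightarrow> real ^ 'n) \<Rightarrow> real ^ 'n \<Rightarrow> real ^ 'n::finite" where
  "lie_bracket Y Z = (\<lambda>x. \<chi> k.
     \<Sum>i\<in>UNIV. Y x $ i * partial i (\<lambda>y. Z y $ k) x - Z x $ i * partial i (\<lambda>y. Y y $ k) x)"

definition curvature_operator ::
    "(real ^ 'n \<Rightarrow> real ^ 'n ^ 'n) \<Rightarrow> (real ^ 'n \<Rightarrow> real ^ 'n) \<Rightarrow> (real ^ 'n \<Rightarrow> real ^ 'n)
      \<Rightarrow> (real ^ 'n \<Rightarrow> real ^ 'n) \<Rightarrow> real ^ 'n \<Rightarrow> real ^ 'n::finite" where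
  "curvature_operator G Y Z V = (\<lambda>x.
     nabla G Y (nabla G Z V) x - nabla G Z (nabla G Y V) x - nabla G (lie_bracket Y Z) V x)"

definition riemann ::
    "(real ^ 'n \<Rightarrow> real ^ 'n ^ 'n) \<Rightarrow> real ^ 'n \<Rightarrow> 'n::finite \<Rightarrow> 'n \<Rightarrow> 'n \<Rightarrow> 'n \<Rightarrow> real" where
  "riemann G x i j k l =
     curvature_operator G (frame i) (frame j) (frame k) x \<bullet> (G x *v frame l x)"

definition ricci ::
    "(real ^ 'n \<Rightarrow> real ^ 'n ^ 'n) \<Rightarrow> real ^ 'n \<Rightarrow> 'n::finite \<Rightarrow> 'n \<Rightarrow> real" where
  "ricci G x j k =
     (\<Sum>i\<in>UNIV. \<Sum>l\<in>UNIV. matrix_inv (G x) $ i $ l * riemann G x i j k l)"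

definition scalar_curv :: "(real ^ 'n \<Rightarrow> real ^ 'n ^ 'n) \<Rightarrow> real ^ 'n::finite \<Rightarrow> real" where
  "scalar_curv G x =
     (\<Sum>j\<in>UNIV. \<Sum>k\<in>UNIV. matrix_inv (G x) $ j $ k * ricci G x j k)"

definition weyl ::
    "(real ^ 'n \<Rightarrow> real ^ 'n ^ 'n) \<Rightarrow> real ^ 'n \<Rightarrow> 'n::finite \<Rightarrow> 'n \<Rightarrow> 'n \<Rightarrow> 'n \<Rightarrow> real" where
  "weyl G x i j k l =
     (let n = real CARD('n) in
      riemann G x i j k l
      - 1 / (n - 2) *
          (G x $ j $ k * ricci G x i l - G x $ i $ k * ricci G x j l
           + G x $ i $ l * ricci G x j k - G x $ j $ l * ricci G x i k)
      + scalar_curv G x / ((n - 1) * (n - 2)) *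
          (G x $ i $ l * G x $ j $ k - G x $ j $ l * G x $ i $ k))"

section \<open>The Yamabe flow\<close>

text \<open>Scalar curvature as a function on the manifold. It does not depend on the chart around
  \<open>p\<close> that is chosen.\<close>

definition scalar_curvature ::
    "('a, 'n::finite) chart set \<Rightarrow> ('a, 'n) metric \<Rightarrow> 'a \<Rightarrow> real" where
  "scalar_curvature A g p =
     (let c = (SOME c. c \<in> A \<and> p \<in> dom_chart c) in scalar_curv (g c) (coord c p))"

definition average_scalar_curvature ::
    "'a topology \<Rightarrow> ('a, 'n::finite) chart set \<Rightarrow> ('a, 'n) metric \<Rightarrow> real" where
  "average_scalar_curvature X A g =
     1 / measure (volume_measure X A g) (topspace X) *
       (LINT p|volume_measure X A g. scalar_curvature A g p)"

text \<open>Finiteness and integrability matter only when the manifold is not compact.\<close>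

definition average_scalar_curvature_defined ::
    "'a topology \<Rightarrow> ('a, 'n::finite) chart set \<Rightarrow> ('a, 'n) metric \<Rightarrow> bool" where
  "average_scalar_curvature_defined X A g \<longleftrightarrow>
     emeasure (volume_measure X A g) (topspace X) < \<infinity> \<and>
     integrable (volume_measure X A g) (scalar_curvature A g)"

text \<open>The family is smooth jointly in time and space, the usual meaning of a smooth
  one-parameter family of metrics.\<close>

definition smooth_metric_family ::
    "('a, 'n::finite) chart set \<Rightarrow> real set \<Rightarrow> (real \<Rightarrow> ('a, 'n) metric) \<Rightarrow> bool" where
  "smooth_metric_family A T g \<longleftrightarrow>
     (\<forall>t\<in>T. riemannian_metric A (g t)) \<and>
     (\<forall>c\<in>A. smooth_on (T \<times> coord c ` dom_chart c) (\<lambda>(t, x). g t c x))"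

definition yamabe_flow ::
    "'a topology \<Rightarrow> ('a, 'n::finite) chart set \<Rightarrow> real set \<Rightarrow> (real \<Rightarrow> ('a, 'n) metric) \<Rightarrow> bool" where
  "yamabe_flow X A T g \<longleftrightarrow>
     smooth_metric_family A T g \<and>
     (\<forall>t\<in>T. average_scalar_curvature_defined X A (g t)) \<and>
     (\<forall>c\<in>A. \<forall>p\<in>dom_chart c. \<forall>t\<in>T. \<forall>i j.
        ((\<lambda>s. g s c (coord c p) $ i $ j) has_real_derivative
           (average_scalar_curvature X A (g t) - scalar_curvature A (g t) p)
             * g t c (coord c p) $ i $ j) (at t within T))"

end

theory Submission
  imports Defs
begin

text \<open>
  At a fixed point all components of the metric satisfy the same scalar linear equation
  \<open>y' = (S - R) y\<close>, so the metrics at two times are conformal, \<open>g(s) = u g(t)\<close>, where \<open>u\<close> is a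
  quotient of diagonal components and hence smooth in space. Since \<open>W[u g] = u W[g]\<close>, the Weyl tensor
  evolves by the factor \<open>u\<close>, whose derivative at \<open>s = t\<close> is \<open>S - R\<close>. No spatial regularity of \<open>S - R\<close>
  and no interchange of time and space derivatives is needed.

  Conformal covariance is a computation at a point. The inverse metric enters the curvature
  undifferentiated when the latter is written with the Christoffel symbols of the first kind:
  \<open>R\<^sub>i\<^sub>j\<^sub>k\<^sub>l = \<partial>\<^sub>i\<Gamma>\<^sub>l\<^sub>,\<^sub>j\<^sub>k - \<partial>\<^sub>j\<Gamma>\<^sub>l\<^sub>,\<^sub>i\<^sub>k - \<langle>\<Gamma>\<^sub>i\<^sub>l, \<Gamma>\<^sub>j\<^sub>k\<rangle> + \<langle>\<Gamma>\<^sub>j\<^sub>l, \<Gamma>\<^sub>i\<^sub>k\<rangle>\<close>. The change of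
  \<open>R\<^sub>i\<^sub>j\<^sub>k\<^sub>l\<close> is then a Kulkarni-Nomizu product of the metric with a symmetric tensor, the symmetry
  of the Hessian of \<open>u\<close> (Young's theorem) being essential, and the Weyl tensor removes such products.
\<close>

section \<open>Partial derivatives\<close>

lemma partial_eqI:
  assumes "(f has_derivative D) (at x)" shows "partial i f x = D (axis i 1)"
  unfolding partial_def using frechet_derivative_at[OF assms] by simp

text \<open>\<open>frechet_derivative\<close> is a choice among all derivatives at the point, so it
  suffices that \<open>f\<close> and \<open>h\<close> have the same ones. This also covers points
  where neither is differentiable.\<close>

lemma partial_cong:
  assumes "open U" "x \<in> U" "\<And>y. y \<in> U \<Longrightarrow> f y = h y"
  shows "partial i f x = partial i h x"
proof -
  have "(f has_derivative D) (at x) \<longleftrightarrow> (h has_derivative D) (at x)" for D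
    using has_derivative_transform_within_open[OF _ assms(1,2), of f D UNIV h]
      has_derivative_transform_within_open[OF _ assms(1,2), of h D UNIV f] assms(3) by auto
  then show ?thesis by (simp add: partial_def frechet_derivative_def)
qed

lemma differentiable_cong_open:
  assumes "h differentiable at x" "open U" "x \<in> U" "\<And>y. y \<in> U \<Longrightarrow> f y = h y"
  shows "f differentiable at x"
  using assms has_derivative_transform_within_open[OF _ assms(2,3), of h _ UNIV f]
  unfolding differentiable_def by auto

lemma partial_const [simp]: "partial i (\<lambda>y. c) x = 0"
  by (simp add: partial_def)

lemma partial_add:
  assumes "f differentiable at x" "h differentiable at x"
  shows "partial i (\<lambda>y. f y + h y) x = partial i f x + partial i h x"
  using assms unfolding frechet_derivative_works
  by (subst partial_eqI[OF has_derivative_add]) (auto simp: partial_def)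

lemma partial_diff:
  assumes "f differentiable at x" "h differentiable at x"
  shows "partial i (\<lambda>y. f y - h y) x = partial i f x - partial i h x"
  using assms unfolding frechet_derivative_works
  by (subst partial_eqI[OF has_derivative_diff]) (auto simp: partial_def)

lemma partial_mult:
  assumes "f differentiable at x" "h differentiable at x"
  shows "partial i (\<lambda>y. f y * h y) x = partial i f x * h x + f x * partial i h x"
  using assms unfolding frechet_derivative_works
  by (subst partial_eqI[OF has_derivative_mult]) (auto simp: partial_def)

lemma partial_sum:
  assumes "\<And>a. a \<in> S \<Longrightarrow> f a differentiable at x"
  shows "partial i (\<lambda>y. \<Sum>a\<in>S. f a y) x = (\<Sum>a\<in>S. partial i (f a) x)"
  using assms unfolding frechet_derivative_works
  by (subst partial_eqI[OF has_derivative_sum]) (auto simp: partial_def)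

lemma partial_divide:
  assumes "f differentiable at x" "h differentiable at x" "h x \<noteq> 0"
  shows "partial i (\<lambda>y. f y / h y) x = (partial i f x * h x - f x * partial i h x) / (h x * h x)"
  using assms unfolding frechet_derivative_works
  by (subst partial_eqI[OF has_derivative_divide']) (auto simp: partial_def)

section \<open>Young's theorem by second differences\<close>

lemma partial_has_real_derivative:
  assumes "f differentiable at (x + s *\<^sub>R axis i 1)"
  shows "((\<lambda>s. f (x + s *\<^sub>R axis i 1)) has_real_derivative partial i f (x + s *\<^sub>R axis i 1)) (at s)"
proof -
  let ?D = "frechet_derivative f (at (x + s *\<^sub>R axis i 1))"
  have D: "(f has_derivative ?D) (at (x + s *\<^sub>R axis i 1))"
    using assms by (simp add: frechet_derivative_works)
  have "((\<lambda>s. x + s *\<^sub>R axis i (1::real)) has_derivative (\<lambda>h. h *\<^sub>R axis i 1)) (at s)"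
    by (auto intro!: derivative_eq_intros)
  from diff_chain_at[OF this D] show ?thesis
    by (simp add: has_field_derivative_def partial_def o_def mult_commute_abs
        linear_scale[OF has_derivative_linear[OF D]])
qed

text \<open>The mean value theorem in direction \<open>i\<close>, applied to the increment of
  \<open>f\<close> in direction \<open>j\<close>, turns the second difference into \<open>s\<close>
  times an increment of \<open>partial i f\<close>. Differentiability of \<open>partial i f\<close>
  at \<open>x\<close> then estimates that increment to first order.\<close>

lemma second_difference_partial:
  fixes f :: "real ^ 'n::finite \<Rightarrow> real"
  assumes U: "open U" "x \<in> U" and f: "\<And>y. y \<in> U \<Longrightarrow> f differentiable at y"
    and fi: "partial i f differentiable at x" and e: "e > 0"
  shows "\<exists>d>0. \<forall>s. 0 < s \<and> s < d \<longrightarrow>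
    \<bar>f (x + s *\<^sub>R axis i 1 + s *\<^sub>R axis j 1) - f (x + s *\<^sub>R axis i 1) - f (x + s *\<^sub>R axis j 1) + f x
      - s\<^sup>2 * partial j (partial i f) x\<bar> \<le> e * s\<^sup>2"
proof -
  define ei where "ei = axis i (1::real)"
  define ej where "ej = axis j (1::real)"
  have ne: "norm ei = 1" "norm ej = 1" by (auto simp: ei_def ej_def)
  let ?D = "frechet_derivative (partial i f) (at x)"
  have D: "(partial i f has_derivative ?D) (at x)"
    using fi by (simp add: frechet_derivative_works)
  have lin: "linear ?D" using has_derivative_linear[OF D] .
  \<comment> \<open>The linear approximation is used at two points, at distances at most
    \<open>2 * s\<close> and \<open>s\<close> from \<open>x\<close>; with tolerance
    \<open>e/3\<close> the two errors add up to \<open>e * s\<close>.\<close>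
  obtain d1 where d1: "d1 > 0" "\<And>y. norm (y - x) < d1 \<Longrightarrow>
      \<bar>partial i f y - partial i f x - ?D (y - x)\<bar> \<le> (e/3) * norm (y - x)"
    using D[unfolded has_derivative_at_alt, THEN conjunct2, rule_format, of "e/3"] e by auto
  obtain d2 where d2: "d2 > 0" "\<And>y. norm (y - x) < d2 \<Longrightarrow> y \<in> U"
    using U open_dist[of U] by (auto simp: dist_norm)
  define d where "d = min d1 d2 / 2"
  have "\<bar>f (x + s *\<^sub>R ei + s *\<^sub>R ej) - f (x + s *\<^sub>R ei) - f (x + s *\<^sub>R ej) + f x
      - s\<^sup>2 * partial j (partial i f) x\<bar> \<le> e * s\<^sup>2" if s: "0 < s" "s < d" for s
  proof -
    have nb: "norm (\<tau> *\<^sub>R ei) \<le> s" "norm (\<tau> *\<^sub>R ei + s *\<^sub>R ej) \<le> 2 * s"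
      if "0 \<le> \<tau>" "\<tau> \<le> s" for \<tau>
      using norm_triangle_ineq[of "\<tau> *\<^sub>R ei" "s *\<^sub>R ej"] that s by (auto simp: ne)
    have sd: "2 * s < d1" "2 * s < d2" using s by (auto simp: d_def)
    have inU: "x + s *\<^sub>R ej + \<tau> *\<^sub>R ei \<in> U" "x + \<tau> *\<^sub>R ei \<in> U" if "0 \<le> \<tau>" "\<tau> \<le> s" for \<tau>
      using nb[OF that] sd s by (auto intro!: d2 simp: algebra_simps)
    \<comment> \<open>The second difference equals \<open>\<psi> s - \<psi> 0\<close>.\<close>
    define \<psi> where "\<psi> \<tau> = f (x + s *\<^sub>R ej + \<tau> *\<^sub>R ei) - f (x + \<tau> *\<^sub>R ei)" for \<tau>
    define \<psi>' where "\<psi>' \<tau> = partial i f (x + s *\<^sub>R ej + \<tau> *\<^sub>R ei) - partial i f (x + \<tau> *\<^sub>R ei)" for \<tau>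
    have "(\<psi> has_real_derivative \<psi>' \<tau>) (at \<tau>)" if "0 \<le> \<tau>" "\<tau> \<le> s" for \<tau>
      unfolding \<psi>_def \<psi>'_def ei_def
      by (intro DERIV_diff partial_has_real_derivative f inU[unfolded ei_def] that)
    then obtain \<tau> where \<tau>: "0 < \<tau>" "\<tau> < s" "\<psi> s - \<psi> 0 = (s - 0) * \<psi>' \<tau>"
      using MVT2[of 0 s \<psi> \<psi>'] s by auto
    have "e/3 * norm (\<tau> *\<^sub>R ei + s *\<^sub>R ej) \<le> e/3 * (2 * s)" "e/3 * norm (\<tau> *\<^sub>R ei) \<le> e/3 * s"
      using nb[of \<tau>] \<tau> e by (intro mult_left_mono; simp)+
    then have
      1: "\<bar>partial i f (x + s *\<^sub>R ej + \<tau> *\<^sub>R ei) - partial i f x - ?D (\<tau> *\<^sub>R ei + s *\<^sub>R ej)\<bar> \<le> e/3 * (2 * s)"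
      and 2: "\<bar>partial i f (x + \<tau> *\<^sub>R ei) - partial i f x - ?D (\<tau> *\<^sub>R ei)\<bar> \<le> e/3 * s"
      using d1(2)[of "x + s *\<^sub>R ej + \<tau> *\<^sub>R ei"] d1(2)[of "x + \<tau> *\<^sub>R ei"] nb[of \<tau>] \<tau> sd s
      by (auto simp add: add.assoc add.commute[of "s *\<^sub>R ej"])
    have 3: "?D (\<tau> *\<^sub>R ei + s *\<^sub>R ej) = ?D (\<tau> *\<^sub>R ei) + s * partial j (partial i f) x"
      by (simp add: linear_add[OF lin] linear_scale[OF lin] partial_def[of j] ej_def)
    have "\<bar>\<psi>' \<tau> - s * partial j (partial i f) x\<bar> \<le> e * s"
      using 1 2 unfolding 3 \<psi>'_def abs_le_iff by argo
    then have "s * \<bar>\<psi>' \<tau> - s * partial j (partial i f) x\<bar> \<le> s * (e * s)"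
      using s by (intro mult_left_mono) auto
    then have "\<bar>s * \<psi>' \<tau> - s\<^sup>2 * partial j (partial i f) x\<bar> \<le> e * s\<^sup>2"
      using s by (simp add: abs_mult_pos' power2_eq_square algebra_simps)
    with \<tau> show ?thesis by (simp add: \<psi>_def algebra_simps)
  qed
  moreover have "d > 0" using d1 d2 by (auto simp: d_def)
  ultimately show ?thesis unfolding ei_def ej_def by blast
qed

text \<open>The second difference is symmetric in \<open>i\<close> and \<open>j\<close>, and after
  division by the square of \<open>s\<close> it tends to either mixed derivative.\<close>

lemma partial_commute:
  fixes f :: "real ^ 'n::finite \<Rightarrow> real"
  assumes U: "open U" "x \<in> U" and f: "\<And>y. y \<in> U \<Longrightarrow> f differentiable at y"
    and fi: "partial i f differentiable at x" "partial j f differentiable at x"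
  shows "partial i (partial j f) x = partial j (partial i f) x"
proof (rule ccontr)
  assume "\<not> ?thesis"
  then have ne: "\<bar>partial i (partial j f) x - partial j (partial i f) x\<bar> > 0" by simp
  \<comment> \<open>The two estimates bound the gap by \<open>2 * e\<close>, which contradicts its
    being \<open>3 * e > 0\<close>.\<close>
  define e where "e = \<bar>partial i (partial j f) x - partial j (partial i f) x\<bar> / 3"
  have e: "e > 0" using ne by (simp add: e_def)
  obtain d1 d2 where d: "d1 > 0" "d2 > 0" and
    1: "\<And>s. 0 < s \<and> s < d1 \<Longrightarrow>
    \<bar>f (x + s *\<^sub>R axis i 1 + s *\<^sub>R axis j 1) - f (x + s *\<^sub>R axis i 1) - f (x + s *\<^sub>R axis j 1) + f x
      - s\<^sup>2 * partial j (partial i f) x\<bar> \<le> e * s\<^sup>2" and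
    2: "\<And>s. 0 < s \<and> s < d2 \<Longrightarrow>
    \<bar>f (x + s *\<^sub>R axis j 1 + s *\<^sub>R axis i 1) - f (x + s *\<^sub>R axis j 1) - f (x + s *\<^sub>R axis i 1) + f x
      - s\<^sup>2 * partial i (partial j f) x\<bar> \<le> e * s\<^sup>2"
    using second_difference_partial[OF U f fi(1) e, of j] second_difference_partial[OF U f fi(2) e, of i]
    by blast
  define s where "s = min d1 d2 / 2"
  have s: "0 < s" "s < d1" "s < d2" using d by (auto simp: s_def)
  have eq: "x + s *\<^sub>R axis j 1 + s *\<^sub>R axis i (1::real) = x + s *\<^sub>R axis i 1 + s *\<^sub>R axis j 1" by simp
  have "\<bar>s\<^sup>2 * partial i (partial j f) x - s\<^sup>2 * partial j (partial i f) x\<bar> \<le> 2 * (e * s\<^sup>2)"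
    using 1[of s] 2[of s] s unfolding eq by (simp add: abs_le_iff)
  then have "s\<^sup>2 * \<bar>partial i (partial j f) x - partial j (partial i f) x\<bar> \<le> s\<^sup>2 * (2 * e)"
    by (simp add: right_diff_distrib[symmetric] abs_mult mult_ac del: right_diff_distrib_numeral)
  then show False using s ne unfolding e_def by simp
qed

section \<open>Differentiability of determinants and inverse matrices\<close>

lemma differentiable_prod:
  fixes f :: "'b \<Rightarrow> 'a::real_normed_vector \<Rightarrow> real"
  assumes "\<And>a. a \<in> S \<Longrightarrow> f a differentiable at x"
  shows "(\<lambda>y. \<Prod>a\<in>S. f a y) differentiable at x"
proof -
  have "((\<lambda>y. \<Prod>a\<in>S. f a y) has_derivative
    (\<lambda>h. \<Sum>i\<in>S. frechet_derivative (f i) (at x) h * (\<Prod>j\<in>S - {i}. f j x))) (at x)"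
    by (rule has_derivative_prod) (use assms in \<open>simp add: frechet_derivative_works\<close>)
  then show ?thesis by (rule differentiableI)
qed

lemma differentiable_det:
  fixes M :: "'a::real_normed_vector \<Rightarrow> real ^ 'n ^ 'n::finite"
  assumes "\<And>i j. (\<lambda>y. M y $ i $ j) differentiable at x"
  shows "(\<lambda>y. det (M y)) differentiable at x"
  unfolding det_def
  by (intro differentiable_sum differentiable_mult differentiable_prod ballI assms) auto

lemma matrix_inv_mult:
  assumes "invertible M"
  shows "M ** matrix_inv M = mat 1" "matrix_inv M ** M = mat 1"
  using someI_ex[OF assms[unfolded invertible_def]] unfolding matrix_inv_def by auto

text \<open>Column \<open>l\<close> of the inverse solves \<open>M *v y = axis l 1\<close>, so
  Cramer's rule applies. The entries become quotients of determinants, whose differentiability is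
  accessible.\<close>

lemma matrix_inv_cramer:
  fixes M :: "real ^ 'n ^ 'n::finite"
  assumes "det M \<noteq> 0"
  shows "matrix_inv M $ k $ l = det (\<chi> i j. if j = k then axis l 1 $ i else M $ i $ j) / det M"
proof -
  have "M *v (matrix_inv M *v axis l 1) = axis l 1"
    using assms by (simp add: matrix_vector_mul_assoc matrix_inv_mult invertible_det_nz)
  then have *: "matrix_inv M *v axis l 1
      = (\<chi> k. det (\<chi> i j. if j = k then axis l 1 $ i else M $ i $ j) / det M)"
    by (rule cramer[OF assms, THEN iffD1])
  have "matrix_inv M $ k $ l = (matrix_inv M *v axis l 1) $ k"
    by (simp add: matrix_vector_mult_basis column_def)
  also have "\<dots> = det (\<chi> i j. if j = k then axis l 1 $ i else M $ i $ j) / det M"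
    by (subst *) simp
  finally show ?thesis .
qed

lemma differentiable_matrix_inv:
  fixes M :: "'a::real_normed_vector \<Rightarrow> real ^ 'n ^ 'n::finite"
  assumes "\<And>i j. (\<lambda>y. M y $ i $ j) differentiable at x" "open U" "x \<in> U"
    "\<And>y. y \<in> U \<Longrightarrow> det (M y) \<noteq> 0"
  shows "(\<lambda>y. matrix_inv (M y) $ k $ l) differentiable at x"
proof (rule differentiable_cong_open[OF _ assms(2,3) matrix_inv_cramer[OF assms(4)]])
  have "(\<lambda>y. (\<chi> i j. if j = k then axis l 1 $ i else M y $ i $ j) $ a $ b) differentiable at x" for a b
    using assms(1) by (cases "b = k") simp_all
  then have "(\<lambda>y. det (\<chi> i j. if j = k then axis l 1 $ i else M y $ i $ j)) differentiable at x"
    by (rule differentiable_det)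
  moreover have "(\<lambda>y. det (M y)) differentiable at x"
    using assms(1) by (rule differentiable_det)
  ultimately show "(\<lambda>y. det (\<chi> i j. if j = k then axis l 1 $ i else M y $ i $ j) / det (M y)) differentiable at x"
    using assms(3,4) by (intro differentiable_divide)
qed

section \<open>Curvature through Christoffel symbols of the first kind\<close>

text \<open>The lowered index is the vector component, so that raising it is multiplication by the
  inverse metric.\<close>

definition christoffel1 ::
    "(real ^ 'n \<Rightarrow> real ^ 'n ^ 'n) \<Rightarrow> 'n::finite \<Rightarrow> 'n \<Rightarrow> real ^ 'n \<Rightarrow> real ^ 'n" where
  "christoffel1 G i j x = (\<chi> l.
     (partial i (\<lambda>y. G y $ j $ l) x + partial j (\<lambda>y. G y $ i $ l) x
      - partial l (\<lambda>y. G y $ i $ j) x) / 2)"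

lemma christoffel_eq:
  "christoffel G k i j x = (matrix_inv (G x) *v christoffel1 G i j x) $ k"
  by (simp add: christoffel_def christoffel1_def matrix_vector_mult_def sum_divide_distrib)

lemma nabla_frame:
  "nabla G (frame i) Z x = (\<chi> m. partial i (\<lambda>y. Z y $ m) x
     + (\<Sum>p\<in>UNIV. christoffel G m i p x * Z x $ p))"
proof -
  have "(\<Sum>q\<in>UNIV. frame i x $ q * h q) = h i" for h :: "_ \<Rightarrow> real"
    by (simp add: frame_def axis_def if_distrib[of "\<lambda>z. z * _"] cong: if_cong)
  moreover have "(\<Sum>q\<in>UNIV. \<Sum>p\<in>UNIV. christoffel G m q p x * frame i x $ q * Z x $ p)
      = (\<Sum>q\<in>UNIV. frame i x $ q * (\<Sum>p\<in>UNIV. christoffel G m q p x * Z x $ p))" for m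
    by (simp add: sum_distrib_left mult_ac)
  ultimately show ?thesis by (simp add: nabla_def)
qed

lemma nabla_frame_frame: "nabla G (frame j) (frame k) = (\<lambda>x. \<chi> m. christoffel G m j k x)"
proof -
  have "(\<Sum>p\<in>UNIV. h p * frame k x $ p) = h k" for h :: "_ \<Rightarrow> real" and x
    by (simp add: frame_def axis_def if_distrib cong: if_cong)
  moreover have "partial j (\<lambda>y. frame k y $ m) x = 0" for m x
    by (simp add: frame_def)
  ultimately show ?thesis by (simp add: fun_eq_iff nabla_frame)
qed

lemma lie_bracket_frame: "lie_bracket (frame i) (frame j) = (\<lambda>x. 0)"
  by (simp add: lie_bracket_def frame_def fun_eq_iff vec_eq_iff)

lemma nabla_zero: "nabla G (\<lambda>x. 0) Z x = 0"
  by (simp add: nabla_def vec_eq_iff)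

text \<open>The classical coordinate formula: coordinate fields commute, so the bracket term
  vanishes, and pairing with \<open>frame l\<close> lowers the upper index.\<close>

lemma riemann_christoffel:
  "riemann G x i j k l = (\<Sum>m\<in>UNIV.
     (partial i (christoffel G m j k) x + (\<Sum>p\<in>UNIV. christoffel G m i p x * christoffel G p j k x)
      - partial j (christoffel G m i k) x - (\<Sum>p\<in>UNIV. christoffel G m j p x * christoffel G p i k x))
     * G x $ m $ l)"
  unfolding riemann_def curvature_operator_def lie_bracket_frame nabla_zero nabla_frame_frame nabla_frame
  by (simp add: inner_vec_def frame_def matrix_vector_mult_basis column_def algebra_simps)

section \<open>Metrics on a coordinate domain and their curvature\<close>

definition twice_differentiable_on :: "(real ^ 'n::finite) set \<Rightarrow> (real ^ 'n \<Rightarrow> real) \<Rightarrow> bool" where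
  "twice_differentiable_on U f \<longleftrightarrow>
     (\<forall>x\<in>U. f differentiable at x \<and> (\<forall>i. partial i f differentiable at x))"

text \<open>These are the data on which the coordinate formula for curvature rests: a symmetric
  invertible matrix whose entries can be differentiated twice.\<close>

locale coordinate_metric =
  fixes U :: "(real ^ 'n::finite) set" and G :: "real ^ 'n \<Rightarrow> real ^ 'n ^ 'n"
  assumes open_U: "open U"
    and metric_sym: "x \<in> U \<Longrightarrow> G x $ i $ j = G x $ j $ i"
    and det_nz: "x \<in> U \<Longrightarrow> det (G x) \<noteq> 0"
    and twice: "twice_differentiable_on U (\<lambda>y. G y $ i $ j)"
begin

lemma diff1: "x \<in> U \<Longrightarrow> (\<lambda>y. G y $ i $ j) differentiable at x"
  and diff2: "x \<in> U \<Longrightarrow> partial k (\<lambda>y. G y $ i $ j) differentiable at x"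
  using twice by (auto simp: twice_differentiable_on_def)

lemma partial_sym: "x \<in> U \<Longrightarrow> partial k (\<lambda>y. G y $ i $ j) x = partial k (\<lambda>y. G y $ j $ i) x"
  by (rule partial_cong[OF open_U]) (auto simp: metric_sym)

text \<open>Compatibility of the Levi-Civita connection with the metric, written with lowered
  indices.\<close>

lemma partial_christoffel1:
  "x \<in> U \<Longrightarrow> partial k (\<lambda>y. G y $ i $ j) x = christoffel1 G k i x $ j + christoffel1 G k j x $ i"
  using partial_sym[of x k i j] partial_sym[of x i j k] partial_sym[of x j i k]
  by (simp add: christoffel1_def field_simps)

lemma christoffel1_commute: "x \<in> U \<Longrightarrow> christoffel1 G i j x = christoffel1 G j i x"
  using partial_sym[of x _ i j] by (simp add: christoffel1_def vec_eq_iff)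

lemma christoffel1_diff: "x \<in> U \<Longrightarrow> (\<lambda>y. christoffel1 G i j y $ l) differentiable at x"
  by (simp add: christoffel1_def diff2)

lemma inv_mult:
  assumes "x \<in> U"
  shows "G x *v (matrix_inv (G x) *v v) = v" "matrix_inv (G x) *v (G x *v v) = v"
  using assms det_nz[of x]
  by (simp_all add: matrix_vector_mul_assoc invertible_det_nz matrix_inv_mult)

lemma christoffel_diff:
  assumes "x \<in> U"
  shows "christoffel G k i j differentiable at x"
proof -
  have "(\<lambda>y. matrix_inv (G y) $ k $ m) differentiable at x" for m
    by (rule differentiable_matrix_inv[OF diff1[OF assms] open_U assms det_nz])
  then have "(\<lambda>y. \<Sum>m\<in>UNIV. matrix_inv (G y) $ k $ m * christoffel1 G i j y $ m) differentiable at x"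
    using christoffel1_diff[OF assms] by simp
  then show ?thesis
    by (simp add: christoffel_eq[abs_def] matrix_vector_mult_def)
qed

lemma lower_christoffel:
  assumes "x \<in> U"
  shows "(\<Sum>m\<in>UNIV. G x $ l $ m * christoffel G m i j x) = christoffel1 G i j x $ l"
proof -
  have "(\<Sum>m\<in>UNIV. G x $ l $ m * christoffel G m i j x)
      = (G x *v (matrix_inv (G x) *v christoffel1 G i j x)) $ l"
    by (simp add: christoffel_eq matrix_vector_mult_def)
  then show ?thesis by (simp add: inv_mult assms)
qed

text \<open>The pairing of covectors induced by the inverse metric.\<close>

definition inv_form where "inv_form x v w = v \<bullet> (matrix_inv (G x) *v w)"

lemma inv_form_christoffel:
  "inv_form x v (christoffel1 G i j x) = (\<Sum>m\<in>UNIV. v $ m * christoffel G m i j x)"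
  by (simp add: inv_form_def inner_vec_def christoffel_eq)

text \<open>The product rule is applied to the lowered symbol, \<open>G\<close> times
  \<open>christoffel\<close>, and metric compatibility splits the derivative of \<open>G\<close>.
  The inverse metric is thereby left undifferentiated; the last sum will cancel against
  \<open>christoffel_quadratic\<close>.\<close>

lemma partial_christoffel:
  assumes x: "x \<in> U"
  shows "(\<Sum>m\<in>UNIV. partial i (christoffel G m j k) x * G x $ m $ l)
    = partial i (\<lambda>y. christoffel1 G j k y $ l) x
      - inv_form x (christoffel1 G i l x) (christoffel1 G j k x)
      - (\<Sum>m\<in>UNIV. christoffel1 G i m x $ l * christoffel G m j k x)"
proof -
  have "partial i (\<lambda>y. christoffel1 G j k y $ l) x
      = partial i (\<lambda>y. \<Sum>m\<in>UNIV. G y $ l $ m * christoffel G m j k y) x"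
    by (rule partial_cong[OF open_U x]) (simp add: lower_christoffel)
  also have "\<dots> = (\<Sum>m\<in>UNIV. partial i (\<lambda>y. G y $ l $ m) x * christoffel G m j k x
      + G x $ l $ m * partial i (christoffel G m j k) x)"
    by (simp add: partial_sum partial_mult diff1 christoffel_diff x)
  also have "\<dots> = (\<Sum>m\<in>UNIV. christoffel1 G i l x $ m * christoffel G m j k x)
      + (\<Sum>m\<in>UNIV. christoffel1 G i m x $ l * christoffel G m j k x)
      + (\<Sum>m\<in>UNIV. partial i (christoffel G m j k) x * G x $ m $ l)"
    by (simp add: partial_christoffel1 x sum.distrib metric_sym[of x l] algebra_simps)
  finally show ?thesis by (simp add: inv_form_christoffel)
qed

lemma christoffel_quadratic:
  assumes x: "x \<in> U"
  shows "(\<Sum>m\<in>UNIV. (\<Sum>p\<in>UNIV. christoffel G m i p x * christoffel G p j k x) * G x $ m $ l)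
    = (\<Sum>p\<in>UNIV. christoffel1 G i p x $ l * christoffel G p j k x)"
proof -
  have "(\<Sum>m\<in>UNIV. (\<Sum>p\<in>UNIV. christoffel G m i p x * christoffel G p j k x) * G x $ m $ l)
    = (\<Sum>m\<in>UNIV. \<Sum>p\<in>UNIV. G x $ l $ m * christoffel G m i p x * christoffel G p j k x)"
    by (simp add: sum_distrib_left sum_distrib_right metric_sym[OF x, of l] mult_ac)
  also have "\<dots> = (\<Sum>p\<in>UNIV. (\<Sum>m\<in>UNIV. G x $ l $ m * christoffel G m i p x) * christoffel G p j k x)"
    by (subst sum.swap) (simp add: sum_distrib_right)
  finally show ?thesis by (simp add: lower_christoffel x)
qed

lemma riemann_christoffel1:
  assumes x: "x \<in> U"
  shows "riemann G x i j k l =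
    partial i (\<lambda>y. christoffel1 G j k y $ l) x - partial j (\<lambda>y. christoffel1 G i k y $ l) x
    - inv_form x (christoffel1 G i l x) (christoffel1 G j k x)
    + inv_form x (christoffel1 G j l x) (christoffel1 G i k x)"
  unfolding riemann_christoffel left_diff_distrib distrib_right sum.distrib sum_subtractf
  by (simp add: christoffel_quadratic partial_christoffel x)

section \<open>The inverse metric as a symmetric bilinear form\<close>

lemma matrix_inv_sym:
  assumes x: "x \<in> U"
  shows "transpose (matrix_inv (G x)) = matrix_inv (G x)"
proof -
  let ?H = "matrix_inv (G x)"
  have inv: "G x ** ?H = mat 1" "?H ** G x = mat 1"
    using det_nz[OF x] by (auto simp: invertible_det_nz matrix_inv_mult)
  have "transpose (G x) = G x"
    using metric_sym[OF x] by (simp add: transpose_def vec_eq_iff)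
  then have "transpose ?H ** G x = mat 1"
    using arg_cong[OF inv(1), of transpose] by (simp add: matrix_transpose_mul)
  then have "(transpose ?H ** G x) ** ?H = ?H" by simp
  then show ?thesis by (simp add: matrix_mul_assoc[symmetric] inv)
qed

lemma inv_form_commute: "x \<in> U \<Longrightarrow> inv_form x v w = inv_form x w v"
  unfolding inv_form_def
  using dot_lmul_matrix[of v "matrix_inv (G x)" w] transpose_matrix_vector[of "matrix_inv (G x)" v]
  by (simp add: matrix_inv_sym inner_commute)

lemma inv_form_linear:
  "inv_form x (v + v') w = inv_form x v w + inv_form x v' w"
  "inv_form x (v - v') w = inv_form x v w - inv_form x v' w"
  "inv_form x (c *\<^sub>R v) w = c * inv_form x v w"
  "inv_form x v (w + w') = inv_form x v w + inv_form x v w'"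
  "inv_form x v (w - w') = inv_form x v w - inv_form x v w'"
  "inv_form x v (c *\<^sub>R w) = c * inv_form x v w"
  by (simp_all add: inv_form_def inner_simps matrix_vector_mult_diff_distrib
      matrix_vector_right_distrib matrix_vector_mult_scaleR)

text \<open>The row \<open>G x $ i\<close> is the covector dual to the \<open>i\<close>-th
  coordinate vector under the metric, so pairing with it reads off a component.\<close>

lemma inv_form_row:
  assumes x: "x \<in> U"
  shows "inv_form x v (G x $ i) = v $ i" "inv_form x (G x $ i) v = v $ i"
proof -
  have "G x $ i = G x *v axis i 1"
    by (simp add: matrix_vector_mult_basis column_def metric_sym[OF x] vec_eq_iff)
  then show "inv_form x v (G x $ i) = v $ i"
    by (simp add: inv_form_def inv_mult x inner_axis)
  then show "inv_form x (G x $ i) v = v $ i"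
    by (simp add: inv_form_commute x)
qed

lemma inv_contract:
  assumes x: "x \<in> U"
  shows "(\<Sum>l\<in>UNIV. matrix_inv (G x) $ i $ l * G x $ l $ j) = (if i = j then 1 else 0)"
proof -
  have "matrix_inv (G x) ** G x = mat 1"
    using det_nz[OF x] by (auto simp: invertible_det_nz matrix_inv_mult)
  from arg_cong[OF this, of "\<lambda>A. A $ i $ j"] show ?thesis
    by (simp add: matrix_matrix_mult_def mat_def)
qed

end

section \<open>Conformal change of the metric\<close>

lemma matrix_inv_scaleR:
  fixes M :: "real ^ 'n ^ 'n::finite"
  assumes "det M \<noteq> 0" "c \<noteq> 0"
  shows "matrix_inv (c *\<^sub>R M) = (1 / c) *\<^sub>R matrix_inv M"
proof -
  have M: "M ** matrix_inv M = mat 1" "matrix_inv M ** M = mat 1"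
    using assms by (auto simp: invertible_det_nz matrix_inv_mult)
  have 1: "(c *\<^sub>R M) ** ((1 / c) *\<^sub>R matrix_inv M) = mat 1"
    "((1 / c) *\<^sub>R matrix_inv M) ** (c *\<^sub>R M) = mat 1"
    using assms M by (simp_all add: matrix_matrix_mult_def vec_eq_iff sum_divide_distrib)
  then have "invertible (c *\<^sub>R M)" by (auto simp: invertible_def)
  from matrix_inv_mult(2)[OF this] 1(1) show ?thesis
    by (metis matrix_mul_assoc matrix_mul_lid matrix_mul_rid)
qed

text \<open>For the flow, \<open>G\<close> and \<open>G'\<close> are the metrics at two times. The
  Hessian of \<open>u\<close> enters the curvature of \<open>G'\<close>, hence the two derivatives
  required of \<open>u\<close>.\<close>

locale conformal_metrics = coordinate_metric U G + conf: coordinate_metric U G'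
  for U :: "(real ^ 'n::finite) set" and G G' +
  fixes u :: "real ^ 'n \<Rightarrow> real"
  assumes twice_u: "twice_differentiable_on U u"
    and u_nz: "y \<in> U \<Longrightarrow> u y \<noteq> 0"
    and conformal: "y \<in> U \<Longrightarrow> G' y = u y *\<^sub>R G y"
begin

lemma u_diff: "x \<in> U \<Longrightarrow> u differentiable at x" "x \<in> U \<Longrightarrow> partial i u differentiable at x"
  using twice_u by (auto simp: twice_differentiable_on_def)

lemma partial_conformal:
  assumes x: "x \<in> U"
  shows "partial k (\<lambda>y. G' y $ i $ j) x
    = partial k u x * G x $ i $ j + u x * partial k (\<lambda>y. G y $ i $ j) x"
proof -
  have "partial k (\<lambda>y. G' y $ i $ j) x = partial k (\<lambda>y. u y * G y $ i $ j) x"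
    by (rule partial_cong[OF open_U x]) (simp add: conformal)
  then show ?thesis by (simp add: partial_mult u_diff diff1 x)
qed

definition du :: "real ^ 'n \<Rightarrow> real ^ 'n" where
  "du x = (\<chi> i. partial i u x)"

lemma christoffel1_conformal:
  assumes x: "x \<in> U"
  shows "christoffel1 G' i j x = u x *\<^sub>R christoffel1 G i j x + (1/2) *\<^sub>R
    (partial i u x *\<^sub>R G x $ j + partial j u x *\<^sub>R G x $ i - G x $ i $ j *\<^sub>R du x)"
  by (simp add: vec_eq_iff christoffel1_def partial_conformal x du_def field_simps)

lemma partial_christoffel1_conformal:
  assumes x: "x \<in> U"
  shows "partial i (\<lambda>y. christoffel1 G' j k y $ l) x
    = partial i u x * christoffel1 G j k x $ l + u x * partial i (\<lambda>y. christoffel1 G j k y $ l) x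
     + (1/2) * (partial i (partial j u) x * G x $ k $ l + partial j u x * partial i (\<lambda>y. G y $ k $ l) x
      + partial i (partial k u) x * G x $ j $ l + partial k u x * partial i (\<lambda>y. G y $ j $ l) x
      - partial i (partial l u) x * G x $ j $ k - partial l u x * partial i (\<lambda>y. G y $ j $ k) x)"
proof -
  have "partial i (\<lambda>y. christoffel1 G' j k y $ l) x
    = partial i (\<lambda>y. u y * christoffel1 G j k y $ l +
    (partial j u y * G y $ k $ l + partial k u y * G y $ j $ l - partial l u y * G y $ j $ k) / 2) x"
    by (rule partial_cong[OF open_U x]) (simp add: christoffel1_conformal du_def mult.commute)
  also have "\<dots> = (partial i u x * christoffel1 G j k x $ l + u x * partial i (\<lambda>y. christoffel1 G j k y $ l) x)
     + (partial i (partial j u) x * G x $ k $ l + partial j u x * partial i (\<lambda>y. G y $ k $ l) x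
      + (partial i (partial k u) x * G x $ j $ l + partial k u x * partial i (\<lambda>y. G y $ j $ l) x)
      - (partial i (partial l u) x * G x $ j $ k + partial l u x * partial i (\<lambda>y. G y $ j $ k) x)) / 2"
    by (simp add: partial_add partial_diff partial_mult partial_divide u_diff diff1 christoffel1_diff x)
  finally show ?thesis by (simp add: field_simps)
qed

lemma inv_form_conformal:
  assumes x: "x \<in> U"
  shows "conf.inv_form x v w = (1 / u x) * inv_form x v w"
  by (simp add: conf.inv_form_def inv_form_def conformal x matrix_inv_scaleR det_nz u_nz
      scaleR_matrix_vector_assoc[symmetric])

text \<open>Minus \<open>u\<close> times the change of the Schouten tensor.\<close>

definition schouten_change :: "real ^ 'n \<Rightarrow> 'n \<Rightarrow> 'n \<Rightarrow> real" where
  "schouten_change x i k =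
     (1/2) * (partial i (partial k u) x - inv_form x (christoffel1 G i k x) (du x))
     - (3/4) * (1 / u x) * partial i u x * partial k u x
     + (1/8) * (1 / u x) * inv_form x (du x) (du x) * G x $ i $ k"

lemma hessian_commute: "x \<in> U \<Longrightarrow> partial i (partial j u) x = partial j (partial i u) x"
  by (rule partial_commute[OF open_U]) (auto simp: u_diff)

text \<open>The transformed symbols are inserted into \<open>riemann_christoffel1\<close>. The
  Hessian terms and the quadratic terms in \<open>du\<close> group into the Kulkarni-Nomizu product
  of \<open>schouten_change\<close> with \<open>G\<close>.\<close>

lemma riemann_conformal:
  assumes x: "x \<in> U"
  shows "riemann G' x i j k l = u x * riemann G x i j k l
     + schouten_change x i k * G x $ j $ l - schouten_change x i l * G x $ j $ k
     - schouten_change x j k * G x $ i $ l + schouten_change x j l * G x $ i $ k"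
proof -
  \<comment> \<open>With \<open>w\<close> for \<open>1 / u x\<close> the computation is polynomial,
    with the single relation \<open>w * u x = 1\<close>.\<close>
  define w where "w = 1 / u x"
  have w: "w * u x = 1" using u_nz[OF x] by (simp add: w_def)
  have quad: "conf.inv_form x (christoffel1 G' i l x) (christoffel1 G' j k x)
    = u x * inv_form x (christoffel1 G i l x) (christoffel1 G j k x)
      + (1/2) * (partial j u x * christoffel1 G i l x $ k + partial k u x * christoffel1 G i l x $ j
        - G x $ j $ k * inv_form x (christoffel1 G i l x) (du x)
        + partial i u x * christoffel1 G j k x $ l + partial l u x * christoffel1 G j k x $ i
        - G x $ i $ l * inv_form x (christoffel1 G j k x) (du x))
      + (w/4) * (partial i u x * partial j u x * G x $ l $ k + partial i u x * partial k u x * G x $ l $ j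
        - 2 * partial i u x * partial l u x * G x $ j $ k
        + partial l u x * partial j u x * G x $ i $ k + partial l u x * partial k u x * G x $ i $ j
        - 2 * partial j u x * partial k u x * G x $ i $ l
        + inv_form x (du x) (du x) * G x $ i $ l * G x $ j $ k)" for i j k l
  proof -
    have du: "du x $ i = partial i u x" for i by (simp add: du_def)
    have "conf.inv_form x (christoffel1 G' i l x) (christoffel1 G' j k x) =
      w * inv_form x (u x *\<^sub>R christoffel1 G i l x + (1/2) *\<^sub>R
        (partial i u x *\<^sub>R G x $ l + partial l u x *\<^sub>R G x $ i - G x $ i $ l *\<^sub>R du x))
       (u x *\<^sub>R christoffel1 G j k x + (1/2) *\<^sub>R
        (partial j u x *\<^sub>R G x $ k + partial k u x *\<^sub>R G x $ j - G x $ j $ k *\<^sub>R du x))"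
      by (simp add: inv_form_conformal x christoffel1_conformal w_def)
    \<comment> \<open>Bilinear expansion, where pairings with rows of \<open>G\<close> collapse to
      components. The factors \<open>w * u x\<close> are kept together so that they can be replaced
      by 1.\<close>
    also have "\<dots> = (w * u x) * (u x * inv_form x (christoffel1 G i l x) (christoffel1 G j k x))
      + (w * u x) * (1/2) * (partial j u x * christoffel1 G i l x $ k + partial k u x * christoffel1 G i l x $ j
        - G x $ j $ k * inv_form x (christoffel1 G i l x) (du x)
        + partial i u x * christoffel1 G j k x $ l + partial l u x * christoffel1 G j k x $ i
        - G x $ i $ l * inv_form x (christoffel1 G j k x) (du x))
      + (w/4) * (partial i u x * partial j u x * G x $ l $ k + partial i u x * partial k u x * G x $ l $ j
        - 2 * partial i u x * partial l u x * G x $ j $ k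
        + partial l u x * partial j u x * G x $ i $ k + partial l u x * partial k u x * G x $ i $ j
        - 2 * partial j u x * partial k u x * G x $ i $ l
        + inv_form x (du x) (du x) * G x $ i $ l * G x $ j $ k)"
      unfolding inv_form_linear inv_form_row[OF x] du inv_form_commute[OF x, of "du x" "christoffel1 G j k x"]
      by (simp add: algebra_simps)
    finally show ?thesis unfolding w by simp
  qed
  \<comment> \<open>What remains is polynomial in the components. The term with
    \<open>partial i (partial j u)\<close> and its mirror image cancel by symmetry of the
    Hessian.\<close>
  show ?thesis
    unfolding conf.riemann_christoffel1[OF x] riemann_christoffel1[OF x] quad
      partial_christoffel1_conformal[OF x] schouten_change_def partial_christoffel1[OF x] w_def[symmetric]
    using metric_sym[OF x, of i j] metric_sym[OF x, of i k] metric_sym[OF x, of i l] metric_sym[OF x, of j k]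
      metric_sym[OF x, of j l] metric_sym[OF x, of k l] hessian_commute[OF x, of i j]
      christoffel1_commute[OF x, of i j]
    by (simp add: algebra_simps)
qed

end

section \<open>Ricci, scalar and Weyl curvature under conformal change\<close>

context conformal_metrics begin

definition schouten_trace :: "real ^ 'n \<Rightarrow> real" where
  "schouten_trace x = (\<Sum>i\<in>UNIV. \<Sum>l\<in>UNIV. matrix_inv (G x) $ i $ l * schouten_change x i l)"

text \<open>Contraction of \<open>riemann_conformal\<close> over \<open>i\<close> and
  \<open>l\<close>: two of the four correction terms give \<open>schouten_change x j k\<close>, one
  gives \<open>- CARD('n)\<close> times it, and one gives the trace times the metric.\<close>

lemma ricci_conformal:
  assumes x: "x \<in> U"
  shows "ricci G' x j k = ricci G x j k
    - ((real CARD('n) - 2) * schouten_change x j k + schouten_trace x * G x $ j $ k) / u x"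
proof -
  let ?H = "matrix_inv (G x)" and ?P = "schouten_change x"
  have t1: "(\<Sum>i\<in>UNIV. \<Sum>l\<in>UNIV. ?H $ i $ l * (?P i k * G x $ j $ l)) = ?P j k"
  proof -
    have "(\<Sum>i\<in>UNIV. \<Sum>l\<in>UNIV. ?H $ i $ l * (?P i k * G x $ j $ l))
      = (\<Sum>i\<in>UNIV. ?P i k * (\<Sum>l\<in>UNIV. ?H $ i $ l * G x $ l $ j))"
      by (simp add: sum_distrib_left metric_sym[OF x, of j] mult_ac)
    then show ?thesis by (simp add: inv_contract x if_distrib cong: if_cong)
  qed
  have t3: "(\<Sum>i\<in>UNIV. \<Sum>l\<in>UNIV. ?H $ i $ l * (?P j k * G x $ i $ l)) = real CARD('n) * ?P j k"
  proof -
    have "(\<Sum>i\<in>UNIV. \<Sum>l\<in>UNIV. ?H $ i $ l * (?P j k * G x $ i $ l))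
      = (\<Sum>i\<in>UNIV. ?P j k * (\<Sum>l\<in>UNIV. ?H $ i $ l * G x $ l $ i))"
      unfolding sum_distrib_left using metric_sym[OF x] by (intro sum.cong refl) simp
    then show ?thesis by (simp add: inv_contract x)
  qed
  have t4: "(\<Sum>i\<in>UNIV. \<Sum>l\<in>UNIV. ?H $ i $ l * (?P j l * G x $ i $ k)) = ?P j k"
  proof -
    have Hs: "?H $ i $ l = ?H $ l $ i" for i l
      using matrix_inv_sym[OF x] by (metis transpose_def vec_lambda_beta)
    have "(\<Sum>i\<in>UNIV. \<Sum>l\<in>UNIV. ?H $ i $ l * (?P j l * G x $ i $ k))
      = (\<Sum>l\<in>UNIV. ?P j l * (\<Sum>i\<in>UNIV. ?H $ l $ i * G x $ i $ k))"
      unfolding sum_distrib_left using Hs by (subst sum.swap) (intro sum.cong refl, simp)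
    then show ?thesis by (simp add: inv_contract x if_distrib cong: if_cong)
  qed
  have t2: "(\<Sum>i\<in>UNIV. \<Sum>l\<in>UNIV. ?H $ i $ l * (?P i l * G x $ j $ k)) = schouten_trace x * G x $ j $ k"
    by (simp add: schouten_trace_def sum_distrib_left sum_distrib_right mult_ac)
  have t0: "(\<Sum>i\<in>UNIV. \<Sum>l\<in>UNIV. ?H $ i $ l * (u x * riemann G x i j k l)) = u x * ricci G x j k"
    by (simp add: ricci_def sum_distrib_left mult_ac)
  have "ricci G' x j k = (\<Sum>i\<in>UNIV. \<Sum>l\<in>UNIV. (1 / u x) * (?H $ i $ l *
      (u x * riemann G x i j k l + ?P i k * G x $ j $ l - ?P i l * G x $ j $ k
       - ?P j k * G x $ i $ l + ?P j l * G x $ i $ k)))"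
    by (simp add: ricci_def conformal x matrix_inv_scaleR det_nz u_nz riemann_conformal)
  also have "\<dots> = (1 / u x) * (u x * ricci G x j k + ?P j k - schouten_trace x * G x $ j $ k
      - real CARD('n) * ?P j k + ?P j k)"
    unfolding sum_distrib_left[symmetric] distrib_left right_diff_distrib sum.distrib sum_subtractf
      t0 t1 t2 t3 t4 by simp
  also have "\<dots> = ricci G x j k - ((real CARD('n) - 2) * ?P j k + schouten_trace x * G x $ j $ k) / u x"
    using u_nz[OF x] by (simp add: field_simps)
  finally show ?thesis .
qed

text \<open>In the trace of \<open>ricci_conformal\<close> the coefficients \<open>n - 2\<close> and
  \<open>n\<close> of \<open>schouten_trace\<close> add up to \<open>2 * (n - 1)\<close>.\<close>

lemma scalar_curv_conformal:
  assumes x: "x \<in> U"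
  shows "scalar_curv G' x = (scalar_curv G x - 2 * (real CARD('n) - 1) * schouten_trace x / u x) / u x"
proof -
  let ?H = "matrix_inv (G x)" and ?P = "schouten_change x"
  have t1: "(\<Sum>j\<in>UNIV. \<Sum>k\<in>UNIV. ?H $ j $ k * G x $ j $ k) = real CARD('n)"
  proof -
    have "(\<Sum>j\<in>UNIV. \<Sum>k\<in>UNIV. ?H $ j $ k * G x $ j $ k) = (\<Sum>j\<in>UNIV. \<Sum>k\<in>UNIV. ?H $ j $ k * G x $ k $ j)"
      using metric_sym[OF x] by (intro sum.cong refl) simp
    then show ?thesis by (simp add: inv_contract x)
  qed
  have "scalar_curv G' x = (\<Sum>j\<in>UNIV. \<Sum>k\<in>UNIV. (1 / u x) * (?H $ j $ k * ricci G x j k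
     - (((real CARD('n) - 2) / u x) * (?H $ j $ k * ?P j k)
        + (schouten_trace x / u x) * (?H $ j $ k * G x $ j $ k))))"
    unfolding scalar_curv_def using u_nz[OF x]
    by (intro sum.cong refl)
      (simp add: ricci_conformal x conformal matrix_inv_scaleR det_nz field_simps)
  also have "\<dots> = (1 / u x) * (scalar_curv G x - (((real CARD('n) - 2) / u x) * schouten_trace x
      + (schouten_trace x / u x) * real CARD('n)))"
    unfolding sum_distrib_left[symmetric] sum.distrib sum_subtractf t1
      scalar_curv_def schouten_trace_def by simp
  also have "\<dots> = (scalar_curv G x - 2 * (real CARD('n) - 1) * schouten_trace x / u x) / u x"
    using u_nz[OF x] by (simp add: field_simps)
  finally show ?thesis .
qed

text \<open>The \<open>schouten_change\<close> terms of the Ricci part cancel those of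
  \<open>riemann_conformal\<close>, and its trace terms cancel the one of the scalar part. Dimension
  at least 3 makes \<open>n - 2\<close> invertible.\<close>

lemma weyl_conformal:
  assumes x: "x \<in> U" and n: "CARD('n) \<ge> 3"
  shows "weyl G' x i j k l = u x * weyl G x i j k l"
proof -
  define n m m1 where "n = real CARD('n)" and "m = n - 2" and "m1 = n - 1"
  have m: "m \<noteq> 0" "m1 \<noteq> 0"
    using assms(2) by (auto simp: n_def m_def m1_def)
  note nm = m_def[symmetric] m1_def[symmetric]
  define v T where "v = u x" and "T = schouten_trace x"
  have v: "v \<noteq> 0" using u_nz[OF x] by (simp add: v_def)
  \<comment> \<open>The free factor \<open>a\<close> lets one rewrite rule serve all four products
    of metric and Ricci tensor.\<close>
  have ric: "1 / m * (v * a * ricci G' x b c)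
      = v * (1 / m * (a * ricci G x b c)) - a * schouten_change x b c - T / m * (a * G x $ b $ c)" for a b c
    unfolding ricci_conformal[OF x] n_def[symmetric] nm v_def[symmetric] T_def[symmetric]
    using v m by (simp add: field_simps)
  have scal: "scalar_curv G' x / (m1 * m) * (v * v * a)
      = v * (scalar_curv G x / (m1 * m) * a) - 2 * (T / m * a)" for a
    unfolding scalar_curv_conformal[OF x] n_def[symmetric] nm v_def[symmetric] T_def[symmetric]
    using v m by (simp add: field_simps)
  have "weyl G' x i j k l = riemann G' x i j k l
      - (1 / m * (v * G x $ j $ k * ricci G' x i l) - 1 / m * (v * G x $ i $ k * ricci G' x j l)
         + 1 / m * (v * G x $ i $ l * ricci G' x j k) - 1 / m * (v * G x $ j $ l * ricci G' x i k))
      + scalar_curv G' x / (m1 * m) * (v * v * (G x $ i $ l * G x $ j $ k - G x $ j $ l * G x $ i $ k))"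
    unfolding weyl_def Let_def n_def[symmetric] nm conformal[OF x] v_def
    by (simp add: right_diff_distrib distrib_left mult_ac)
  also have "\<dots> = v * (riemann G x i j k l
      - (1 / m * (G x $ j $ k * ricci G x i l) - 1 / m * (G x $ i $ k * ricci G x j l)
         + 1 / m * (G x $ i $ l * ricci G x j k) - 1 / m * (G x $ j $ l * ricci G x i k))
      + scalar_curv G x / (m1 * m) * (G x $ i $ l * G x $ j $ k - G x $ j $ l * G x $ i $ k))"
    unfolding ric scal riemann_conformal[OF x] v_def[symmetric]
    by (simp add: algebra_simps)
  also have "\<dots> = v * weyl G x i j k l"
    unfolding weyl_def Let_def n_def[symmetric] nm
    by (simp add: right_diff_distrib distrib_left mult_ac)
  finally show ?thesis by (simp add: v_def)
qed

end

section \<open>Evolution of the Weyl tensor\<close>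

text \<open>The quotient rule holds on all of \<open>U\<close> and shows each partial derivative to
  be a quotient of differentiable functions. This supplies the regularity of the conformal
  factor.\<close>

lemma twice_differentiable_on_divide:
  assumes U: "open U" and f: "twice_differentiable_on U f" and h: "twice_differentiable_on U h"
    and nz: "\<And>x. x \<in> U \<Longrightarrow> h x \<noteq> 0"
  shows "twice_differentiable_on U (\<lambda>x. f x / h x)"
  unfolding twice_differentiable_on_def
proof (intro ballI conjI allI)
  fix x i assume x: "x \<in> U"
  note d = f[unfolded twice_differentiable_on_def, rule_format]
    h[unfolded twice_differentiable_on_def, rule_format]
  show "(\<lambda>x. f x / h x) differentiable at x"
    using d nz x by (intro differentiable_divide) auto
  have "(\<lambda>y. (partial i f y * h y - f y * partial i h y) / (h y * h y)) differentiable at x"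
    using d nz x by (intro differentiable_divide differentiable_diff differentiable_mult) auto
  then show "partial i (\<lambda>x. f x / h x) differentiable at x"
    by (rule differentiable_cong_open[OF _ U x]) (use d nz in \<open>auto intro!: partial_divide\<close>)
qed

text \<open>On an open set derivatives within the set are ordinary ones. The first derivative in
  direction \<open>axis k 1\<close> has the partial derivatives as its components, and
  \<open>Ck_on\<close> makes it differentiable again.\<close>

lemma smooth_on_twice_differentiable:
  fixes G :: "real ^ 'n::finite \<Rightarrow> real ^ 'n ^ 'n"
  assumes U: "open U" and "smooth_on U G"
  shows "twice_differentiable_on U (\<lambda>x. G x $ i $ j)"
proof -
  have "Ck_on (Suc (Suc 0)) U G" using assms(2) by (simp add: smooth_on_def)
  then obtain G' where G': "\<And>x. x \<in> U \<Longrightarrow> (G has_derivative G' x) (at x)"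
    and Ck: "\<And>v. Ck_on (Suc 0) U (\<lambda>x. G' x v)"
    unfolding Ck_on.simps(2)[of "Suc 0"] using at_within_open[OF _ U] by metis
  then have G'': "(\<lambda>x. G' x v) differentiable at x" if "x \<in> U" for x v
  proof -
    obtain f' where "\<forall>x\<in>U. ((\<lambda>x. G' x v) has_derivative f' x) (at x within U)"
      using Ck[of v] by auto
    then show ?thesis
      using that at_within_open[OF that U] by (metis differentiableI)
  qed
  have bl: "bounded_linear (\<lambda>M :: real ^ 'n ^ 'n. M $ i $ j)"
    by (intro bounded_linear_compose[OF bounded_linear_vec_nth] bounded_linear_vec_nth)
  have G'_comp: "((\<lambda>x. G x $ i $ j) has_derivative (\<lambda>v. G' x v $ i $ j)) (at x)" if "x \<in> U" for x
    using bounded_linear.has_derivative[OF bl G'[OF that]] .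
  have "partial k (\<lambda>x. G x $ i $ j) differentiable at x" if x: "x \<in> U" for k x
  proof (rule differentiable_cong_open[OF _ U x partial_eqI[OF G'_comp]])
    show "(\<lambda>x. G' x (axis k 1) $ i $ j) differentiable at x"
      using differentiable_chain_at[OF G''[OF x] bounded_linear_imp_differentiable[OF bl]] by (simp add: o_def)
  qed
  then show ?thesis
    using G'_comp by (auto simp: twice_differentiable_on_def differentiable_def)
qed

lemma coordinate_metric_chart:
  fixes A :: "('a, 'n::finite) chart set"
  assumes "smooth_manifold X A" "riemannian_metric A g" "c \<in> A"
  shows "coordinate_metric (coord c ` dom_chart c) (g c)"
proof
  let ?U = "coord c ` dom_chart c"
  show U: "open ?U"
    using assms by (auto simp: smooth_manifold_def is_chart_def)
  have g: "transpose (g c x) = g c x" "v \<noteq> 0 \<Longrightarrow> v \<bullet> (g c x *v v) > 0" if "x \<in> ?U" for x v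
    using assms(2,3) that unfolding riemannian_metric_def by blast+
  show "g c x $ i $ j = g c x $ j $ i" if "x \<in> ?U" for x i j
    using g(1)[OF that] by (metis transpose_def vec_lambda_beta)
  show "det (g c x) \<noteq> 0" if "x \<in> ?U" for x
  proof -
    \<comment> \<open>Positive definiteness makes the kernel trivial, hence the matrix
      invertible.\<close>
    have "v = 0" if "g c x *v v = 0" for v
      using g(2)[OF \<open>x \<in> ?U\<close>, of v] that by auto
    then show ?thesis
      by (metis invertible_det_nz invertible_left_inverse matrix_left_invertible_ker)
  qed
  show "twice_differentiable_on ?U (\<lambda>y. g c y $ i $ j)" for i j
    using assms(2,3) U by (auto simp: riemannian_metric_def intro: smooth_on_twice_differentiable)
qed

text \<open>Both components solve the same linear homogeneous equation in time, so their quotient is constant.\<close>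

lemma yamabe_flow_quotient:
  fixes A :: "('a, 'n::finite) chart set"
  assumes flow: "yamabe_flow X A T g" and T: "is_interval T" and "c \<in> A" "p \<in> dom_chart c" "s \<in> T" "t \<in> T"
    and nz: "\<And>r. r \<in> T \<Longrightarrow> g r c (coord c p) $ a $ b \<noteq> 0"
  shows "g s c (coord c p) $ i $ j / g s c (coord c p) $ a $ b
    = g t c (coord c p) $ i $ j / g t c (coord c p) $ a $ b"
proof -
  define f where "f r = average_scalar_curvature X A (g r) - scalar_curvature A (g r) p" for r
  have D: "((\<lambda>s. g s c (coord c p) $ i $ j) has_real_derivative f r * g r c (coord c p) $ i $ j) (at r within T)"
    if "r \<in> T" for r i j
    using flow assms(3,4) that unfolding yamabe_flow_def f_def by blast
  have "((\<lambda>s. g s c (coord c p) $ i $ j / g s c (coord c p) $ a $ b) has_real_derivative 0) (at r within T)"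
    if r: "r \<in> T" for r
    \<comment> \<open>Both derivatives carry the same factor \<open>f r\<close>, so the numerator of
      the quotient rule vanishes.\<close>
    using DERIV_divide[OF D[OF r, of i j] D[OF r, of a b] nz[OF r]] by (simp add: mult_ac)
  moreover have "convex T" using T by (simp add: is_interval_convex)
  ultimately obtain C where "\<And>r. r \<in> T \<Longrightarrow> g r c (coord c p) $ i $ j / g r c (coord c p) $ a $ b = C"
    using has_field_derivative_zero_constant[of T "\<lambda>s. g s c (coord c p) $ i $ j / g s c (coord c p) $ a $ b"]
    by blast
  then show ?thesis using assms(5,6) by simp
qed

theorem theorem3p7:
  fixes X :: "'a topology" and A :: "('a, 'n::finite) chart set"
    and T :: "real set" and g :: "real \<Rightarrow> ('a, 'n) metric"
    and c :: "('a, 'n) chart" and p :: 'a and t :: real and i j k l :: 'n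
  assumes "smooth_manifold X A" and "CARD('n) \<ge> 3"
    and "is_interval T" and "interior T \<noteq> {}"
    and "yamabe_flow X A T g"
    and "c \<in> A" and "p \<in> dom_chart c" and "t \<in> T"
  shows "((\<lambda>s. weyl (g s c) (coord c p) i j k l) has_real_derivative
            (average_scalar_curvature X A (g t) - scalar_curvature A (g t) p)
              * weyl (g t c) (coord c p) i j k l) (at t within T)"
proof -
  define U where "U = coord c ` dom_chart c"
  \<comment> \<open>An arbitrary index: every diagonal entry of a positive definite matrix is
    positive and can serve as denominator.\<close>
  define a :: 'n where "a = undefined"
  define u where "u s x = g s c x $ a $ a / g t c x $ a $ a" for s x
  have metric: "riemannian_metric A (g s)" if "s \<in> T" for s
    using assms(5) that by (simp add: yamabe_flow_def smooth_metric_family_def)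
  have cm: "coordinate_metric U (g s c)" if "s \<in> T" for s
    unfolding U_def using assms(1,6) metric[OF that] by (intro coordinate_metric_chart)
  have pos: "g s c x $ a $ a > 0" if "s \<in> T" "x \<in> U" for s x
  proof -
    have "axis a 1 \<bullet> (g s c x *v axis a 1) > 0"
      using metric[OF that(1)] assms(6) that(2) unfolding riemannian_metric_def U_def
      by (metis axis_eq_0_iff zero_neq_one)
    then show ?thesis by (simp add: inner_axis' matrix_vector_mult_basis column_def)
  qed
  \<comment> \<open>Each ratio of a component to the \<open>a\<close>-th diagonal one is constant in
    time, so all components scale by the same factor between \<open>t\<close> and
    \<open>s\<close>.\<close>
  have conf: "g s c x = u s x *\<^sub>R g t c x" if s: "s \<in> T" and x: "x \<in> U" for s x
  proof -
    obtain q where q: "q \<in> dom_chart c" "x = coord c q" using x by (auto simp: U_def)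
    have "g s c x $ i $ j / g s c x $ a $ a = g t c x $ i $ j / g t c x $ a $ a" for i j
      unfolding q(2) using pos x q
      by (intro yamabe_flow_quotient[OF assms(5,3,6) q(1) s assms(8)]) (metis less_irrefl)
    then show ?thesis
      using pos[OF s x] pos[OF assms(8) x] by (simp add: vec_eq_iff u_def field_simps)
  qed
  have x: "coord c p \<in> U" using assms(7) by (simp add: U_def)
  have weyl: "weyl (g s c) (coord c p) i j k l = u s (coord c p) * weyl (g t c) (coord c p) i j k l"
    if s: "s \<in> T" for s
  proof -
    interpret G: coordinate_metric U "g t c" using cm assms(8) .
    interpret G': coordinate_metric U "g s c" using cm s .
    interpret conformal_metrics U "g t c" "g s c" "u s"
    proof
      show "twice_differentiable_on U (u s)"
        unfolding u_def using G.open_U G'.twice G.twice 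
        by (rule twice_differentiable_on_divide) (use pos[OF assms(8)] in \<open>simp add: less_imp_neq[THEN not_sym]\<close>)
      show "u s y \<noteq> 0" if "y \<in> U" for y
        using pos[OF s that] pos[OF assms(8) that] by (simp add: u_def)
      show "g s c y = u s y *\<^sub>R g t c y" if "y \<in> U" for y
        using s that by (rule conf)
    qed
    show ?thesis using x assms(2) by (rule weyl_conformal)
  qed
  \<comment> \<open>Division by the constant \<open>g t c (coord c p) $ a $ a\<close> turns the flow
    equation for this component into the derivative of \<open>u\<close> at time \<open>t\<close>,
    where \<open>u\<close> equals 1.\<close>
  have "((\<lambda>s. g s c (coord c p) $ a $ a) has_real_derivative
      (average_scalar_curvature X A (g t) - scalar_curvature A (g t) p) * g t c (coord c p) $ a $ a)
      (at t within T)"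
    using assms(5-8) by (simp add: yamabe_flow_def)
  from DERIV_cdivide[OF this, of "g t c (coord c p) $ a $ a"]
  have "((\<lambda>s. u s (coord c p)) has_real_derivative
      (average_scalar_curvature X A (g t) - scalar_curvature A (g t) p)) (at t within T)"
    using pos[OF assms(8) x] by (simp add: u_def)
  from DERIV_cmult_right[OF this, of "weyl (g t c) (coord c p) i j k l"]
  show ?thesis
    \<comment> \<open>The identity \<open>weyl\<close> holds at every time in \<open>T\<close>, so
      any radius will do.\<close>
    by (rule has_field_derivative_transform_within[OF _ zero_less_one assms(8)]) (simp add: weyl)
qed

end
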